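(* Let $\mathbb{F}$ be an arbitrary field and let $A_1,\dots,A_n$ be non-empty finite subsets of $\mathbb{F}$, with $S=\sum_{i=1}^n|A_i|$ and $t=\max_i|A_i|$. Let $B=A_1\times\cdots\times A_n$ and let $P\in\mathbb{F}[x_1,\dots,x_n]$ be a polynomial of degree $d$ that does not vanish on all of $B$ (i.e., $P(b)\neq 0$ for some $b\in B$). If $S\ge n+d$ and $t\ge 2$, then the number of points $b\in B$ with $P(b)\neq 0$ is at least $t^{\frac{S-n-d}{t-1}}$. *)

theory Defs
  imports Complex_Main "HOL-Library.Poly_Mapping" "HOL-Library.FuncSet"
begin

text \<open>
  Polynomials are finitely supported coefficient functions on monomials, a monomial being a
  finitely supported exponent vector indexed by \<open>nat\<close>. The ring operations are those that
  the type \<open>\<Rightarrow>\<^sub>0\<close> already carries (convolution product).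
\<close>

type_synonym 'a mpoly = "(nat \<Rightarrow>\<^sub>0 nat) \<Rightarrow>\<^sub>0 'a"

definition mon_degree :: "(nat \<Rightarrow>\<^sub>0 nat) \<Rightarrow> nat" where
  "mon_degree m = (\<Sum>i\<in>Poly_Mapping.keys m. Poly_Mapping.lookup m i)"

text \<open>The zero polynomial gets total degree 0.\<close>

definition total_degree :: "'a::zero mpoly \<Rightarrow> nat" where
  "total_degree p = Max (insert 0 (mon_degree ` Poly_Mapping.keys p))"

definition mpoly_vars :: "'a::zero mpoly \<Rightarrow> nat set" where
  "mpoly_vars p = (\<Union>m\<in>Poly_Mapping.keys p. Poly_Mapping.keys m)"

definition mpoly_eval :: "'a::comm_semiring_1 mpoly \<Rightarrow> (nat \<Rightarrow> 'a) \<Rightarrow> 'a" where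
  "mpoly_eval p x = (\<Sum>m\<in>Poly_Mapping.keys p.
     Poly_Mapping.lookup p m * (\<Prod>i\<in>Poly_Mapping.keys m. x i ^ Poly_Mapping.lookup m i))"

end

theory Submission
  imports Defs "HOL-Analysis.Convex"
begin

text \<open>
  Induct on the number of variables, and for a distinguished variable \<open>x\<^sub>i\<close> on \<open>|A\<^sub>i|\<close>. If some
  restriction \<open>x\<^sub>i = c\<close> with \<open>c \<in> A\<^sub>i\<close> vanishes on the remaining box, then \<open>P\<close> agrees on the box
  with \<open>(x\<^sub>i - c) Q\<close> where \<open>deg Q < deg P\<close>; passing to \<open>Q\<close> and \<open>A\<^sub>i - {c}\<close> keeps the non-zeros and
  does not lower the exponent \<open>(S - n - d) / (t - 1)\<close>. Otherwise each of the \<open>|A\<^sub>i|\<close> restrictions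
  satisfies the bound for one variable less, and \<open>a \<ge> t powr ((a - 1) / (t - 1))\<close> for
  \<open>1 \<le> a \<le> t\<close> by concavity of the logarithm.
\<close>

text \<open>Functions that some polynomial of degree at most \<open>d\<close> computes. Only values
  on the box matter, so the argument runs on functions; \<open>d\<close> is just an upper bound, so
  the zero function causes no special case.\<close>

inductive poly_fun :: "nat \<Rightarrow> (('i \<Rightarrow> 'a::comm_ring_1) \<Rightarrow> 'a) \<Rightarrow> bool" where
  const: "poly_fun d (\<lambda>x. c)"
| add: "poly_fun d f \<Longrightarrow> poly_fun d g \<Longrightarrow> poly_fun d (\<lambda>x. f x + g x)"
| var: "poly_fun d f \<Longrightarrow> poly_fun (Suc d) (\<lambda>x. x i * f x)"

lemma poly_fun_Suc: "poly_fun d f \<Longrightarrow> poly_fun (Suc d) f"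
  by (induction rule: poly_fun.induct) (auto intro: poly_fun.intros)

lemma poly_fun_mono: "poly_fun d f \<Longrightarrow> d \<le> e \<Longrightarrow> poly_fun e f"
  by (induction e) (auto simp: le_Suc_eq intro: poly_fun_Suc)

lemma poly_fun_cmult: "poly_fun d f \<Longrightarrow> poly_fun d (\<lambda>x. a * f x)"
proof (induction rule: poly_fun.induct)
  case (var d f i)
  then have "poly_fun (Suc d) (\<lambda>x. x i * (a * f x))"
    by (intro poly_fun.var)
  then show ?case by (simp add: mult.left_commute)
qed (auto simp: distrib_left intro: poly_fun.intros)

lemma poly_fun_fun_upd: "poly_fun d f \<Longrightarrow> poly_fun d (\<lambda>x. f (x(i := c)))"
proof (induction rule: poly_fun.induct)
  case (var d f j)
  then show ?case
    by (cases "j = i") (auto intro: poly_fun.var poly_fun_cmult poly_fun_Suc)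
qed (auto intro: poly_fun.intros)

lemma poly_fun_sum:
  assumes "\<And>m. m \<in> M \<Longrightarrow> poly_fun d (f m)"
  shows "poly_fun d (\<lambda>x. \<Sum>m\<in>M. f m x)"
  using assms by (induction M rule: infinite_finite_induct) (auto intro: poly_fun.intros)

lemma poly_fun_power_mult: "poly_fun d f \<Longrightarrow> poly_fun (k + d) (\<lambda>x. x i ^ k * f x)"
  by (induction k) (auto simp: mult.assoc intro: poly_fun.var)

lemma poly_fun_monom: "poly_fun (\<Sum>i\<in>K. k i) (\<lambda>x. \<Prod>i\<in>K. x i ^ k i)"
  by (induction K rule: infinite_finite_induct) (auto intro: poly_fun.const poly_fun_power_mult)

lemma poly_fun_mpoly_eval: "poly_fun (total_degree P) (mpoly_eval P)"
proof -
  have "mon_degree m \<le> total_degree P" if "m \<in> Poly_Mapping.keys P" for m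
    using that by (auto simp: total_degree_def)
  then have "poly_fun (total_degree P)
      (\<lambda>x. Poly_Mapping.lookup P m * (\<Prod>i\<in>Poly_Mapping.keys m. x i ^ Poly_Mapping.lookup m i))"
    if "m \<in> Poly_Mapping.keys P" for m
    unfolding mon_degree_def using that by (intro poly_fun_cmult poly_fun_mono[OF poly_fun_monom])
  then have "poly_fun (total_degree P) (\<lambda>x. mpoly_eval P x)"
    unfolding mpoly_eval_def by (rule poly_fun_sum)
  then show ?thesis .
qed

text \<open>Division by \<open>x i - c\<close>, with the restriction to \<open>x i = c\<close> as
  remainder. Since \<open>d - 1\<close> is truncated, the last conjunct records separately that a
  constant has quotient zero; this later yields \<open>d > 0\<close>.\<close>

lemma poly_fun_quotient:
  assumes "poly_fun d f"
  shows "\<exists>q. (\<forall>x. f x = (x i - c) * q x + f (x(i := c))) \<and> poly_fun (d - 1) q \<and>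
    (d = 0 \<longrightarrow> (\<forall>x. q x = 0))"
  using assms
proof (induction rule: poly_fun.induct)
  case (const d a)
  show ?case
    by (rule exI[of _ "\<lambda>x. 0"]) (auto intro: poly_fun.const)
next
  case (add d f g)
  then obtain p where
    p: "\<forall>x. f x = (x i - c) * p x + f (x(i := c))" "poly_fun (d - 1) p" "d = 0 \<longrightarrow> (\<forall>x. p x = 0)"
    by (elim exE conjE) (rule that)
  from add obtain q where
    q: "\<forall>x. g x = (x i - c) * q x + g (x(i := c))" "poly_fun (d - 1) q" "d = 0 \<longrightarrow> (\<forall>x. q x = 0)"
    by (elim exE conjE) (rule that)
  have eq: "f x + g x = (x i - c) * (p x + q x) + (f (x(i := c)) + g (x(i := c)))" for x
    using p(1)[rule_format, of x] q(1)[rule_format, of x] by (simp add: algebra_simps)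
  show ?case
    by (intro exI[of _ "\<lambda>x. p x + q x"] conjI allI, rule eq)
      (use p(2,3) q(2,3) in \<open>auto intro: poly_fun.add\<close>)
next
  case (var d f j)
  then obtain q where
    q: "\<forall>x. f x = (x i - c) * q x + f (x(i := c))" "poly_fun (d - 1) q" "d = 0 \<longrightarrow> (\<forall>x. q x = 0)"
    by (elim exE conjE) (rule that)
  show ?case
  proof (cases "j = i")
    case True
    \<comment> \<open>Write \<open>x i * f x = (x i - c) * f x + c * f x\<close> and expand only the
      second \<open>f x\<close> by the induction hypothesis.\<close>
    have eq: "x i * f x = (x i - c) * (f x + c * q x) + c * f (x(i := c))" for x
      using arg_cong[OF q(1)[rule_format, of x], of "(*) c"] by (simp add: algebra_simps)
    have "poly_fun d (\<lambda>x. f x + c * q x)"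
      using var.hyps poly_fun_mono[OF q(2), of d] by (intro poly_fun.add poly_fun_cmult) auto
    then show ?thesis
      unfolding True
      by (intro exI[of _ "\<lambda>x. f x + c * q x"] conjI allI) (simp_all only: eq fun_upd_same, simp_all)
  next
    case False
    have eq: "x j * f x = (x i - c) * (x j * q x) + x j * f (x(i := c))" for x
      using arg_cong[OF q(1)[rule_format, of x], of "(*) (x j)"] by (simp add: algebra_simps)
    \<comment> \<open>For \<open>d = 0\<close> the bound holds because \<open>q\<close> is zero;
      otherwise the new factor raises \<open>d - 1\<close> back to \<open>d\<close>.\<close>
    have "poly_fun d (\<lambda>x. x j * q x)"
      using q(2,3) poly_fun.var[OF q(2), of j] by (cases d) (auto intro: poly_fun.const)
    then show ?thesis
      using False by (intro exI[of _ "\<lambda>x. x j * q x"] conjI allI) (simp_all only: eq fun_upd_other, simp_all)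
  qed
qed

lemma card_PiE_insert_Collect:
  assumes "i \<notin> I" "finite I" "\<And>j. j \<in> insert i I \<Longrightarrow> finite (A j)"
  shows "card {x \<in> Pi\<^sub>E (insert i I) A. Q x} = (\<Sum>c\<in>A i. card {x \<in> Pi\<^sub>E I A. Q (x(i := c))})"
proof -
  let ?X = "SIGMA c:A i. {x \<in> Pi\<^sub>E I A. Q (x(i := c))}"
  have "{x \<in> Pi\<^sub>E (insert i I) A. Q x} = (\<lambda>(c, x). x(i := c)) ` ?X"
    unfolding PiE_insert_eq by auto
  moreover have "inj_on (\<lambda>(c, x). x(i := c)) ?X"
    using inj_combinator[OF assms(1), of A] by (rule inj_on_subset) auto
  moreover have "finite (Pi\<^sub>E I A)"
    using assms(2,3) by (auto intro: finite_PiE)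
  ultimately show ?thesis
    using assms(3) by (simp add: card_image)
qed

text \<open>With \<theta> the weight placing \<open>a\<close> between 1 and \<open>t\<close>,
  convexity of \<open>exp\<close> on the segment from 0 to \<open>ln t\<close> bounds
  \<open>t powr \<theta>\<close> by the chord value, which is \<open>a\<close>.\<close>

lemma powr_ratio_le:
  fixes a t :: real
  assumes "1 \<le> a" "a \<le> t" "1 < t"
  shows "t powr ((a - 1) / (t - 1)) \<le> a"
proof -
  define \<theta> where "\<theta> = (a - 1) / (t - 1)"
  have \<theta>: "0 \<le> \<theta>" "\<theta> \<le> 1" and "\<theta> * (t - 1) = a - 1"
    using assms by (auto simp: \<theta>_def)
  then have a: "a = (1 - \<theta>) * 1 + \<theta> * t"
    by (simp add: algebra_simps)
  have "exp ((1 - \<theta>) *\<^sub>R 0 + \<theta> *\<^sub>R ln t) \<le> (1 - \<theta>) * exp 0 + \<theta> * exp (ln t)"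
    using \<theta> by (intro convex_onD[OF exp_convex]) auto
  then show ?thesis
    using assms unfolding \<theta>_def[symmetric] by (subst a) (simp add: powr_def)
qed

text \<open>Here \<open>t\<close> is any real bound on the set sizes, so it can stay fixed while
  sets shrink or coordinates are dropped. The exponent may become negative along the way. The
  subtraction in \<open>card (A i) - 1\<close> is on naturals; it is exact because a non-zero in the
  box forces every \<open>A i\<close> to be non-empty.\<close>

lemma card_nonzeros_poly_fun_ge:
  fixes f :: "('i \<Rightarrow> 'a::idom) \<Rightarrow> 'a" and t :: real
  assumes "finite I" "poly_fun d f" "1 < t"
    and "\<And>i. i \<in> I \<Longrightarrow> finite (A i)" "\<And>i. i \<in> I \<Longrightarrow> card (A i) \<le> t"
    and "\<exists>x \<in> Pi\<^sub>E I A. f x \<noteq> 0"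
  shows "t powr (((\<Sum>i\<in>I. card (A i) - 1) - real d) / (t - 1)) \<le> card {x \<in> Pi\<^sub>E I A. f x \<noteq> 0}"
  using assms
proof (induction I arbitrary: d f A rule: finite_induct)
  case empty
  \<comment> \<open>The empty product has one point, a non-zero of \<open>f\<close>, so the count is
    1 and the exponent is at most 0.\<close>
  have "t powr (- real d / (t - 1)) \<le> t powr 0"
    using \<open>1 < t\<close> by (intro powr_mono) (auto simp: divide_nonpos_pos)
  moreover have "{x. x = (\<lambda>_. undefined) \<and> f x \<noteq> 0} = {\<lambda>_. undefined}"
    using empty.prems by auto
  ultimately show ?case using \<open>1 < t\<close> by simp
next
  case (insert i I)
  from insert.prems show ?case
  \<comment> \<open>The inner induction handles a vanishing slice; the outer hypothesis remains
    available for all \<open>d\<close>, \<open>f\<close> and \<open>A\<close> when no slice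
    vanishes.\<close>
  proof (induction "card (A i)" arbitrary: d f A rule: less_induct)
    case less
    let ?E = "\<lambda>A d. ((\<Sum>j\<in>insert i I. card (A j) - 1) - real d) / (t - 1)"
    have fin: "finite (A i)" using less.prems by simp
    obtain b where b: "b \<in> Pi\<^sub>E (insert i I) A" "f b \<noteq> 0"
      using less.prems by blast
    show ?case
    proof (cases "\<exists>c\<in>A i. \<forall>x\<in>Pi\<^sub>E I A. f (x(i := c)) = 0")
      case True
      then obtain c where c: "c \<in> A i" "\<And>x. x \<in> Pi\<^sub>E I A \<Longrightarrow> f (x(i := c)) = 0" by blast
      obtain q where q: "\<forall>x. f x = (x i - c) * q x + f (x(i := c))" "poly_fun (d - 1) q"
        "d = 0 \<longrightarrow> (\<forall>x. q x = 0)"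
        using poly_fun_quotient[OF \<open>poly_fun d f\<close>, of i c]
        by (elim exE conjE) (rule that)
      have f: "f x = (x i - c) * q x" if "x \<in> Pi\<^sub>E (insert i I) A" for x
      proof -
        \<comment> \<open>Resetting coordinate \<open>i\<close> gives a point of the smaller box
          with the same slice point \<open>x(i := c)\<close>, so the remainder vanishes.\<close>
        have "x(i := undefined) \<in> Pi\<^sub>E I A"
          using that \<open>i \<notin> I\<close> by (auto simp: PiE_iff extensional_def)
        from c(2)[OF this] show ?thesis using q(1)[rule_format, of x] by simp
      qed
      define A' where "A' = A(i := A i - {c})"
      \<comment> \<open>Without zero divisors, \<open>f x\<close> is non-zero exactly when
        \<open>x i\<close> differs from \<open>c\<close> and \<open>q x\<close> is non-zero.\<close>
      have nz: "{x \<in> Pi\<^sub>E (insert i I) A'. q x \<noteq> 0} = {x \<in> Pi\<^sub>E (insert i I) A. f x \<noteq> 0}"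
      proof -
        have "Pi\<^sub>E (insert i I) A' = {x \<in> Pi\<^sub>E (insert i I) A. x i \<noteq> c}"
          using \<open>i \<notin> I\<close> by (auto simp: A'_def PiE_iff extensional_def split: if_splits)
        then show ?thesis using f by auto
      qed
      have "b \<in> {x \<in> Pi\<^sub>E (insert i I) A'. q x \<noteq> 0}"
        using nz b by blast
      then have b': "b \<in> Pi\<^sub>E (insert i I) A'" "q b \<noteq> 0" by auto
      have "d > 0" using q(3) b'(2) by auto
      have card: "card (A i) = Suc (card (A' i))"
        using fin c(1) by (simp add: A'_def card_Suc_Diff1 del: card_Diff_insert)
      have "b i \<in> A' i" using b'(1) by auto
      then have "card (A' i) > 0"
        using fin by (auto simp: A'_def card_gt_0_iff)
      have "(\<Sum>j\<in>I. card (A' j) - 1) = (\<Sum>j\<in>I. card (A j) - 1)"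
        using \<open>i \<notin> I\<close> by (intro sum.cong) (auto simp: A'_def)
      \<comment> \<open>Both truncated subtractions are genuine, so the sum and the degree bound
        each drop by one and the exponent is unchanged.\<close>
      then have "?E A' (d - 1) = ?E A d"
        using card \<open>card (A' i) > 0\<close> \<open>d > 0\<close> insert.hyps by simp
      moreover have "t powr ?E A' (d - 1) \<le> card {x \<in> Pi\<^sub>E (insert i I) A'. q x \<noteq> 0}"
      proof (rule less.hyps)
        show "real (card (A' j)) \<le> t" if "j \<in> insert i I" for j
          using less.prems(4)[OF that] card by (cases "j = i") (auto simp: A'_def)
        show "finite (A' j)" if "j \<in> insert i I" for j
          using less.prems(3)[OF that] by (auto simp: A'_def)
      qed (use card q(2) b' \<open>1 < t\<close> in auto)
      ultimately show ?thesis unfolding nz by (simp only:)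
    next
      case False
      let ?e = "((\<Sum>j\<in>I. card (A j) - 1) - real d) / (t - 1)"
      have IH: "t powr ?e \<le> card {x \<in> Pi\<^sub>E I A. f (x(i := c)) \<noteq> 0}" if "c \<in> A i" for c
        using that False less.prems by (intro insert.IH poly_fun_fun_upd) blast+
      have "A i \<noteq> {}" using b(1) by auto
      then have pos: "1 \<le> card (A i)" using fin by (simp add: Suc_le_eq card_gt_0_iff)
      \<comment> \<open>The share of coordinate \<open>i\<close> in the exponent costs at most a
        factor \<open>card (A i)\<close>, the number of slices.\<close>
      have "?E A d = (card (A i) - 1) / (t - 1) + ?e"
        using insert.hyps by (simp add: add_divide_distrib diff_divide_distrib)
      then have "t powr ?E A d = t powr ((real (card (A i)) - 1) / (t - 1)) * t powr ?e"
        using pos by (simp add: powr_add)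
      also have "\<dots> \<le> card (A i) * t powr ?e"
        using powr_ratio_le[of "card (A i)" t] pos less.prems by (intro mult_right_mono) auto
      also have "\<dots> = (\<Sum>c\<in>A i. t powr ?e)" by simp
      also have "\<dots> \<le> (\<Sum>c\<in>A i. real (card {x \<in> Pi\<^sub>E I A. f (x(i := c)) \<noteq> 0}))"
        using IH by (rule sum_mono)
      also have "\<dots> = card {x \<in> Pi\<^sub>E (insert i I) A. f x \<noteq> 0}"
        using card_PiE_insert_Collect[of i I A "\<lambda>x. f x \<noteq> 0"] insert.hyps less.prems by simp
      finally show ?thesis .
    qed
  qed
qed

theorem theorem15:
  fixes A :: "nat \<Rightarrow> 'a::field set"
    and P :: "'a mpoly"
    and B :: "(nat \<Rightarrow> 'a) set"
    and n d S t :: nat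
  assumes "n \<ge> 1"
    and "\<And>i. i \<in> {1..n} \<Longrightarrow> finite (A i)"
    and "\<And>i. i \<in> {1..n} \<Longrightarrow> A i \<noteq> {}"
    and "S = (\<Sum>i=1..n. card (A i))"
    and "t = Max ((\<lambda>i. card (A i)) ` {1..n})"
    and "B = (\<Pi>\<^sub>E i\<in>{1..n}. A i)"
    and "mpoly_vars P \<subseteq> {1..n}"
    and "total_degree P = d"
    and "\<exists>b\<in>B. mpoly_eval P b \<noteq> 0"
    and "S \<ge> n + d"
    and "t \<ge> 2"
  shows "real (card {b \<in> B. mpoly_eval P b \<noteq> 0})
           \<ge> real t powr ((real S - real n - real d) / (real t - 1))"
proof -
  \<comment> \<open>Non-emptiness makes the natural-number subtractions add up to
    \<open>S - n\<close>.\<close>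
  have "card (A i) \<ge> 1" if "i \<in> {1..n}" for i
    using assms(2,3)[OF that] by (simp add: Suc_le_eq card_gt_0_iff)
  then have "real (\<Sum>i=1..n. card (A i) - 1) = (\<Sum>i=1..n. real (card (A i)) - 1)"
    by simp
  then have "real (\<Sum>i=1..n. card (A i) - 1) = real S - real n"
    using assms(4) by (simp add: sum_subtractf)
  moreover have "card (A i) \<le> t" if "i \<in> {1..n}" for i
    using that assms(5) by simp
  then have "real t powr ((real (\<Sum>i=1..n. card (A i) - 1) - real d) / (real t - 1))
      \<le> card {x \<in> Pi\<^sub>E {1..n} A. mpoly_eval P x \<noteq> 0}"
    using assms poly_fun_mpoly_eval[of P] by (intro card_nonzeros_poly_fun_ge) auto
  ultimately show ?thesis using assms(6) by simp
qed

end
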